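(* A $k$-dimensional $C^1$ open strictly convex domain $\Omega$ in $\mathbb{R}^k$ is a $k$-dimensional ellipsoid if and only if the triple ratios for all of its ideal triangles are equal to $1$.
   Context: Here $\Omega\subset\mathbb{R}^k$ is a $k$-dimensional strictly convex open domain with $C^1$ boundary (strictly convex: convex, with no line segment contained in the boundary). An ideal triangle $\triangle$ of $\Omega$ is an oriented Euclidean triangle with all three vertices on $\partial\Omega$. It lies in a unique $2$-dimensional affine plane $P\subset\mathbb{R}^k$, and the triple ratio of $\triangle$ is defined as its triple ratio in the strictly convex planar domain $\Omega\cap P$, as follows. View $P\cong\mathbb{R}^2\subset\mathbb{RP}^2$. To each vertex of $\triangle$ associate the flag in $\mathbb{R}^3$ given by the vertex (a line in $\mathbb{R}^3$) and the tangent line to $\partial(\Omega\cap P)$ at that vertex (a plane in $\mathbb{R}^3$). Let $F,G,H$ be the flags of the three vertices in their cyclic order. Let $f_1$ span the line of $F$ and $f_1,f_2$ span the plane of $F$, put $f^1=f_1$, $f^2=f_1\wedge f_2$, and similarly for $G$ and $H$. With $\Delta$ the standard volume form on $\mathbb{R}^3$, $$T=\frac{\Delta(f^2\wedge g^1)\,\Delta(g^2\wedge h^1)\,\Delta(f^1\wedge h^2)}{\Delta(f^2\wedge h^1)\,\Delta(f^1\wedge g^2)\,\Delta(g^1\wedge h^2)},$$ which is independent of the choices. Equivalently, if the tangent lines at the vertices $a,b,c$ are $L_1,L_2,L_3$, and $u=L_2\cap L_3$, $v=L_1\cap L_3$, $w=L_1\cap L_2$, then $T=\frac{|wb|\,|uc|\,|va|}{|bu|\,|cv|\,|aw|}$,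 where $|\cdot|$ is Euclidean distance and segment lengths are allowed to be infinite.
   Formalization: The domain is additionally assumed bounded (and nonempty); without boundedness the claim fails, e.g. the region y > x^2 in the plane is open, strictly convex and C^1 with all triple ratios equal to 1, but is not an ellipsoid. *)

theory Defs
  imports "HOL-Analysis.Analysis"
begin

definition strictly_convex :: "'a::euclidean_space set \<Rightarrow> bool" where
  "strictly_convex S \<longleftrightarrow>
     convex S \<and> (\<forall>x y. x \<noteq> y \<longrightarrow> \<not> closed_segment x y \<subseteq> frontier S)"

(* Near every boundary point, S is a strict sublevel set of a C^1 function rho with
   nowhere vanishing gradient g. *)
definition C1_boundary :: "'a::euclidean_space set \<Rightarrow> bool" where
  "C1_boundary S \<longleftrightarrow>
     (\<forall>p \<in> frontier S. \<exists>U \<rho> g. open U \<and> p \<in> U \<and>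
        (\<forall>x \<in> U. (\<rho> has_derivative (\<lambda>h. g x \<bullet> h)) (at x)) \<and>
        continuous_on U g \<and> (\<forall>x \<in> U. g x \<noteq> 0) \<and>
        S \<inter> U = {x \<in> U. \<rho> x < (0::real)} \<and>
        frontier S \<inter> U = {x \<in> U. \<rho> x = 0})"

definition open_ellipsoid :: "'a::euclidean_space set \<Rightarrow> bool" where
  "open_ellipsoid S \<longleftrightarrow>
     (\<exists>A c. linear A \<and> inj A \<and> S = (\<lambda>x::'a. c + A x) ` ball 0 1)"

(* v is the velocity at p of a curve running in C; v = 0 is included. *)
definition tangent_vector :: "'a::euclidean_space set \<Rightarrow> 'a \<Rightarrow> 'a \<Rightarrow> bool" where
  "tangent_vector C p v \<longleftrightarrow>
     (\<exists>\<gamma> e. e > 0 \<and> \<gamma> 0 = p \<and> (\<forall>t::real. \<bar>t\<bar> < e \<longrightarrow> \<gamma> t \<in> C) \<and>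
        (\<gamma> has_vector_derivative v) (at 0))"

definition tangent_line :: "'a::euclidean_space set \<Rightarrow> 'a \<Rightarrow> 'a set" where
  "tangent_line C p = {p + v | v. tangent_vector C p v}"

text \<open>A flag is a pair (line, plane) of nested linear subspaces of the real vector space of
  dimension 3.\<close>

type_synonym flag = "(real^3) set \<times> (real^3) set"

definition flag_basis :: "flag \<Rightarrow> real^3 \<Rightarrow> real^3 \<Rightarrow> bool" where
  "flag_basis F f1 f2 \<longleftrightarrow>
     f1 \<noteq> 0 \<and> f2 \<notin> span {f1} \<and> fst F = span {f1} \<and> snd F = span {f1, f2}"

(* The volume form evaluated on u \<and> v \<and> w. *)
definition vol :: "real^3 \<Rightarrow> real^3 \<Rightarrow> real^3 \<Rightarrow> real" where
  "vol u v w = det (vector [u, v, w] :: real^3^3)"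

(* The value does not depend on the chosen bases when the flags are in general position. *)
definition flag_triple_ratio :: "flag \<Rightarrow> flag \<Rightarrow> flag \<Rightarrow> real" where
  "flag_triple_ratio F G H =
     (THE T. \<exists>f1 f2 g1 g2 h1 h2. flag_basis F f1 f2 \<and> flag_basis G g1 g2 \<and> flag_basis H h1 h2 \<and>
        T = (vol f1 f2 g1 * vol g1 g2 h1 * vol f1 h1 h2) /
            (vol f1 f2 h1 * vol f1 g1 g2 * vol g1 h1 h2))"

definition homog :: "real^2 \<Rightarrow> real^3" where
  "homog x = vector [x $ 1, x $ 2, 1]"

definition vertex_flag :: "(real^2) set \<Rightarrow> real^2 \<Rightarrow> flag" where
  "vertex_flag D p = (span {homog p}, span (homog ` tangent_line (frontier D) p))"

definition planar_triple_ratio :: "(real^2) set \<Rightarrow> real^2 \<Rightarrow> real^2 \<Rightarrow> real^2 \<Rightarrow> real" where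
  "planar_triple_ratio D a b c =
     flag_triple_ratio (vertex_flag D a) (vertex_flag D b) (vertex_flag D c)"

(* An ordered triple represents the triangle with the orientation a, b, c; the triple ratio is
   invariant under cyclic rotations. *)
definition ideal_triangle :: "'a::euclidean_space set \<Rightarrow> 'a \<Rightarrow> 'a \<Rightarrow> 'a \<Rightarrow> bool" where
  "ideal_triangle \<Omega> a b c \<longleftrightarrow>
     a \<in> frontier \<Omega> \<and> b \<in> frontier \<Omega> \<and> c \<in> frontier \<Omega> \<and> \<not> collinear {a, b, c}"

definition plane_chart :: "(real^2 \<Rightarrow> 'a::euclidean_space) \<Rightarrow> 'a set \<Rightarrow> bool" where
  "plane_chart \<phi> P \<longleftrightarrow>
     (\<exists>A q. linear A \<and> inj A \<and> \<phi> = (\<lambda>x. q + A x)) \<and> range \<phi> = P"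

(* The plane through a, b, c is identified with the coordinate plane by an affine chart, whose
   choice does not affect the value; the preimage of \<Omega> under the chart is then the planar
   section of \<Omega>. *)
definition triple_ratio :: "'a::euclidean_space set \<Rightarrow> 'a \<Rightarrow> 'a \<Rightarrow> 'a \<Rightarrow> real" where
  "triple_ratio \<Omega> a b c =
     (THE T. \<exists>\<phi>. plane_chart \<phi> (affine hull {a, b, c}) \<and>
        T = planar_triple_ratio (\<phi> -` \<Omega>) (inv \<phi> a) (inv \<phi> b) (inv \<phi> c))"

end

theory Submission imports Defs begin

text \<open>Let \<open>n a\<close> be the outer normal at a boundary point \<open>a\<close>, of arbitrary length, and put
  \<open>K a b = n a \<bullet> (b - a)\<close>. The triple ratio of \<open>a, b, c\<close> is
  \<open>(K a b * K b c * K c a) / (K a c * K b a * K c b)\<close>. For an ellipsoid, suitably scaled normals make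
  \<open>K\<close> symmetric. Conversely, if all triple ratios are \<open>1\<close>, the normals can be rescaled so that \<open>K\<close> is
  symmetric on the boundary. Being affine in \<open>b\<close>, it is then the restriction of a symmetric bilinear
  form in the homogeneous coordinates of \<open>a\<close> and \<open>b\<close>, and since \<open>K a a = 0\<close> the boundary lies on the
  quadric of that form. Negativity of \<open>K\<close> off the diagonal, applied to chords in all directions,
  shows that the quadric is an ellipsoid.\<close>

subsection \<open>Smooth boundary points\<close>

text \<open>All that is used of \<open>C\<^sup>1\<close>-smoothness at \<open>p\<close>: the directions pointing into \<open>S\<close> form an
  open half space. This property passes to planar sections.\<close>

definition smooth_normal :: "'a::euclidean_space set \<Rightarrow> 'a \<Rightarrow> 'a \<Rightarrow> bool" where
  "smooth_normal S p n \<longleftrightarrow> p \<in> frontier S \<and>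
     (\<forall>x\<in>S. n \<bullet> (x - p) < 0) \<and> (\<forall>v. n \<bullet> v < 0 \<longrightarrow> (\<exists>t>0. p + t *\<^sub>R v \<in> S))"

lemma smooth_normalD:
  assumes "smooth_normal S p n"
  shows "p \<in> frontier S" "p \<in> closure S"
    "\<And>x. x \<in> S \<Longrightarrow> n \<bullet> (x - p) < 0"
    "\<And>v. n \<bullet> v < 0 \<Longrightarrow> \<exists>t>0. p + t *\<^sub>R v \<in> S"
  using assms by (auto simp: smooth_normal_def frontier_def)

lemma smooth_normal_neq_0:
  assumes "smooth_normal S p n" "S \<noteq> {}"
  shows "n \<noteq> 0"
  using assms by (auto simp: smooth_normal_def)

lemma smooth_normal_closure_le:
  assumes "smooth_normal S p n" "x \<in> closure S"
  shows "n \<bullet> (x - p) \<le> 0"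
proof -
  have "closed {x. n \<bullet> (x - p) \<le> 0}"
    by (intro closed_Collect_le continuous_intros)
  moreover have "S \<subseteq> {x. n \<bullet> (x - p) \<le> 0}"
    using assms(1) by (auto simp: smooth_normal_def less_imp_le)
  ultimately show ?thesis
    using assms(2) closure_minimal by blast
qed

text \<open>Every point of a segment from a closure point to an interior point, except possibly the
  first endpoint, is interior. Hence a ray from \<open>p\<close> that is in \<open>S\<close> at
  parameter \<open>t\<close> has been in \<open>S\<close> since leaving \<open>p\<close>.\<close>

lemma open_convex_ray:
  fixes S :: "'a::euclidean_space set"
  assumes "open S" "convex S" "p \<in> closure S" "p + t *\<^sub>R v \<in> S" "0 < s" "s \<le> t"
  shows "p + s *\<^sub>R v \<in> S"
proof -
  have "p - (s/t) *\<^sub>R (p - (p + t *\<^sub>R v)) \<in> interior S"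
    by (rule mem_interior_closure_convex_shrink) (use assms in \<open>auto simp: interior_open\<close>)
  also have "p - (s/t) *\<^sub>R (p - (p + t *\<^sub>R v)) = p + s *\<^sub>R v"
    using assms by auto
  finally show ?thesis using interior_subset by blast
qed

text \<open>The normal is the gradient of a local defining function. The sign of its directional
  derivative decides the side on which a ray starts, and convexity carries this local information to
  all of \<open>S\<close>.\<close>

lemma C1_boundary_smooth_normal:
  fixes S :: "'a::euclidean_space set"
  assumes "open S" "convex S" "C1_boundary S" "p \<in> frontier S"
  obtains n where "smooth_normal S p n"
proof -
  obtain U \<rho> g where U: "open U" "p \<in> U"
    and d: "\<forall>x \<in> U. (\<rho> has_derivative (\<lambda>h. g x \<bullet> h)) (at x)"
    and g0: "\<forall>x \<in> U. g x \<noteq> 0"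
    and SU: "S \<inter> U = {x \<in> U. \<rho> x < (0::real)}"
    and FU: "frontier S \<inter> U = {x \<in> U. \<rho> x = 0}"
    using assms(3)[unfolded C1_boundary_def, rule_format, OF assms(4)]
    by (elim exE conjE) (rule that)
  have \<rho>0: "\<rho> p = 0" using FU U assms(4) by auto
  have ev: "\<exists>\<delta>>0. \<forall>t. 0 < t \<and> t < \<delta> \<longrightarrow> p + t *\<^sub>R v \<in> U" for v
  proof -
    have "((\<lambda>t. p + t *\<^sub>R v) \<longlongrightarrow> p) (at_right (0::real))"
      by (auto intro!: tendsto_eq_intros)
    from topological_tendstoD[OF this U] show ?thesis
      unfolding eventually_at_right_field by (auto simp: )
  qed
  have der: "((\<lambda>t. \<rho> (p + t *\<^sub>R v)) has_real_derivative (g p \<bullet> v)) (at 0)" for v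
  proof -
    have "((\<lambda>t. p + t *\<^sub>R v) has_derivative (\<lambda>t. t *\<^sub>R v)) (at 0)"
      by (auto intro!: derivative_eq_intros)
    moreover have "(\<rho> has_derivative (\<lambda>h. g p \<bullet> h)) (at (p + 0 *\<^sub>R v))"
      using d U by simp
    ultimately have "((\<lambda>t. \<rho> (p + t *\<^sub>R v)) has_derivative (\<lambda>t. g p \<bullet> (t *\<^sub>R v))) (at 0)"
      by (rule has_derivative_compose)
    then show ?thesis by (simp add: has_field_derivative_def mult.commute[of _ "g p \<bullet> v"])
  qed
  have B: "\<exists>t>0. p + t *\<^sub>R v \<in> S" if v: "g p \<bullet> v < 0" for v
  proof -
    obtain \<delta> where \<delta>: "\<delta> > 0" "\<And>t. 0 < t \<Longrightarrow> t < \<delta> \<Longrightarrow> p + t *\<^sub>R v \<in> U" using ev by blast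
    obtain \<delta>' where \<delta>': "\<delta>' > 0" "\<And>t. 0 < t \<Longrightarrow> t < \<delta>' \<Longrightarrow> \<rho> (p + t *\<^sub>R v) < 0"
      using DERIV_neg_dec_right[OF der v] \<rho>0 by auto
    define t where "t = min \<delta> \<delta>' / 2"
    have "t > 0" "t < \<delta>" "t < \<delta>'" using \<delta>(1) \<delta>'(1) by (auto simp: t_def)
    then show ?thesis using \<delta>(2) \<delta>'(2) SU by blast
  qed
  \<comment> \<open>By convexity the initial part of the segment from \<open>p\<close> to
    \<open>x\<close> lies in \<open>S\<close>, where \<open>\<rho>\<close> is negative, while a
    positive derivative makes \<open>\<rho>\<close> positive there.\<close>
  have pos: False if x: "x \<in> S" and v: "g p \<bullet> (x - p) > 0" for x
  proof -
    obtain \<delta> where \<delta>: "\<delta> > 0" "\<And>t. 0 < t \<Longrightarrow> t < \<delta> \<Longrightarrow> p + t *\<^sub>R (x-p) \<in> U" using ev by blast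
    obtain \<delta>' where \<delta>': "\<delta>' > 0" "\<And>t. 0 < t \<Longrightarrow> t < \<delta>' \<Longrightarrow> \<rho> (p + t *\<^sub>R (x-p)) > 0"
      using DERIV_pos_inc_right[OF der v] \<rho>0 by auto
    define t where "t = min 1 (min \<delta> \<delta>' / 2)"
    have t: "t > 0" "t < \<delta>" "t < \<delta>'" "t \<le> 1" using \<delta>(1) \<delta>'(1) by (auto simp: t_def)
    have "p + t *\<^sub>R (x-p) \<in> S"
      by (rule open_convex_ray[where t=1]) (use assms x t in \<open>auto simp: frontier_def\<close>)
    moreover have "p + t *\<^sub>R (x-p) \<in> U" "\<rho> (p + t *\<^sub>R (x-p)) > 0" using \<delta>(2) \<delta>'(2) t by auto
    ultimately have "p + t *\<^sub>R (x-p) \<in> {x \<in> U. \<rho> x < 0}" using SU by blast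
    then show False using \<open>\<rho> (p + t *\<^sub>R (x-p)) > 0\<close> by simp
  qed
  \<comment> \<open>A zero pairing reduces to the positive case: a small move of \<open>x\<close>
    along \<open>g p\<close> stays in the open set \<open>S\<close> and increases the
    pairing.\<close>
  have A: "g p \<bullet> (x - p) < 0" if x: "x \<in> S" for x
  proof (rule ccontr)
    assume c: "\<not> g p \<bullet> (x - p) < 0"
    have "((\<lambda>t. x + t *\<^sub>R g p) \<longlongrightarrow> x) (at_right (0::real))"
      by (auto intro!: tendsto_eq_intros)
    from topological_tendstoD[OF this \<open>open S\<close> x]
    obtain b :: real where b: "b > 0" "\<And>t. 0 < t \<Longrightarrow> t < b \<Longrightarrow> x + t *\<^sub>R g p \<in> S"
      unfolding eventually_at_right_field by auto
    have "x + (b/2) *\<^sub>R g p \<in> S" using b by auto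
    moreover have "g p \<bullet> (x + (b/2) *\<^sub>R g p - p) > 0"
    proof -
      have "g p \<bullet> (x + (b/2) *\<^sub>R g p - p) = g p \<bullet> (x - p) + (b/2) * (g p \<bullet> g p)"
        by (simp add: algebra_simps)
      moreover have "g p \<bullet> g p > 0" using g0 U by simp
      ultimately show ?thesis using c b(1) by (smt (verit) mult_pos_pos half_gt_zero)
    qed
    ultimately show False using pos by blast
  qed
  show thesis using A B assms(4) by (intro that[of "g p"]) (auto simp: smooth_normal_def)
qed

text \<open>Equality would put the whole segment from \<open>p\<close> to \<open>q\<close> into the
  supporting hyperplane, hence outside \<open>S\<close> but in its closure, which strict convexity
  forbids.\<close>

lemma smooth_normal_less:
  fixes S :: "'a::euclidean_space set"
  assumes "open S" "strictly_convex S" "smooth_normal S p n" "q \<in> frontier S" "p \<noteq> q"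
  shows "n \<bullet> (q - p) < 0"
proof (rule ccontr)
  assume c: "\<not> ?thesis"
  have q: "q \<in> closure S" using assms(4) by (auto simp: frontier_def)
  then have 0: "n \<bullet> (q - p) = 0" using smooth_normal_closure_le[OF assms(3) q] c by simp
  have "closed_segment p q \<subseteq> closure S"
    using assms(2) smooth_normalD(2)[OF assms(3)] q
    by (intro closed_segment_subset) (auto simp: strictly_convex_def)
  moreover have "x \<notin> S" if x: "x \<in> closed_segment p q" for x
  proof -
    obtain u where "x = (1 - u) *\<^sub>R p + u *\<^sub>R q" using x unfolding closed_segment_def by blast
    then have "x - p = u *\<^sub>R (q - p)" by (simp add: algebra_simps)
    then have "n \<bullet> (x - p) = 0" using 0 by simp
    then show ?thesis using smooth_normalD(3)[OF assms(3)] by fastforce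
  qed
  ultimately have "closed_segment p q \<subseteq> frontier S"
    using assms(1) by (auto simp: frontier_def interior_open)
  then show False using assms(2,5) by (auto simp: strictly_convex_def)
qed

text \<open>The tangent curve is obtained by pushing the points of the supporting line into \<open>S\<close> until
  they meet the boundary; by smoothness the push is of smaller order than the distance to \<open>p\<close>.\<close>

lemma tangent_vector_iff:
  fixes S :: "'a::euclidean_space set"
  assumes "open S" "convex S" "S \<noteq> {}" "smooth_normal S p n"
  shows "tangent_vector (frontier S) p v \<longleftrightarrow> n \<bullet> v = 0"
proof
  assume "tangent_vector (frontier S) p v"
  then obtain \<gamma> e where \<gamma>: "e > 0" "\<gamma> 0 = p" "\<And>t::real. \<bar>t\<bar> < e \<Longrightarrow> \<gamma> t \<in> frontier S"
    "(\<gamma> has_vector_derivative v) (at 0)" unfolding tangent_vector_def by blast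
  \<comment> \<open>The supporting functional restricted to the curve has a maximum at
    \<open>0\<close>, so its derivative vanishes there.\<close>
  have "((\<lambda>t. n \<bullet> (\<gamma> t - p)) has_real_derivative (n \<bullet> v)) (at 0)"
    using \<gamma>(4) unfolding has_vector_derivative_def has_field_derivative_def
    by (auto intro!: derivative_eq_intros simp: mult.commute)
  moreover have "\<forall>y. \<bar>0 - y\<bar> < e \<longrightarrow> n \<bullet> (\<gamma> y - p) \<le> n \<bullet> (\<gamma> 0 - p)"
    using \<gamma>(2,3) smooth_normal_closure_le[OF assms(4)] by (auto simp: frontier_def)
  ultimately show "n \<bullet> v = 0" using DERIV_local_max \<gamma>(1) by blast
next
  assume nv: "n \<bullet> v = 0"
  \<comment> \<open>An inward direction; the curve will be
    \<open>p + t *\<^sub>R v + s t *\<^sub>R u\<close> with a correction \<open>s\<close>.\<close>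
  define u where "u = - n"
  have nu: "n \<bullet> u < 0" using smooth_normal_neq_0[OF assms(4,3)] by (simp add: u_def)
  note pc = smooth_normalD(2)[OF assms(4)]
  obtain \<delta> where \<delta>: "\<delta> > 0" "p + \<delta> *\<^sub>R u \<in> S" using smooth_normalD(4)[OF assms(4) nu] by blast
  have "((\<lambda>t. p + \<delta> *\<^sub>R u + t *\<^sub>R v) \<longlongrightarrow> p + \<delta> *\<^sub>R u) (at (0::real))"
    by (auto intro!: tendsto_eq_intros)
  from topological_tendstoD[OF this \<open>open S\<close> \<delta>(2)]
  obtain e where e: "e > 0" "\<And>t::real. \<bar>t\<bar> < e \<Longrightarrow> p + \<delta> *\<^sub>R u + t *\<^sub>R v \<in> S"
    unfolding eventually_at using \<delta>(2) by (auto simp: dist_real_def) 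
       (metis add.right_neutral scaleR_zero_left)
  \<comment> \<open>The point \<open>p + t *\<^sub>R v\<close> lies on the supporting hyperplane,
    outside \<open>S\<close>, and its shift by \<open>\<delta> *\<^sub>R u\<close> lies inside, so
    the segment joining them crosses the boundary.\<close>
  have ex: "\<exists>s. 0 \<le> s \<and> s \<le> \<delta> \<and> p + t *\<^sub>R v + s *\<^sub>R u \<in> frontier S" if t: "\<bar>t\<bar> < e" for t
  proof -
    have "p + t *\<^sub>R v \<notin> S" using smooth_normalD(3)[OF assms(4), of "p + t *\<^sub>R v"] nv by auto
    moreover have "(p + t *\<^sub>R v) + \<delta> *\<^sub>R u \<in> S" using e(2)[OF t] by (simp add: algebra_simps)
    moreover have "connected (closed_segment (p + t *\<^sub>R v) ((p + t *\<^sub>R v) + \<delta> *\<^sub>R u))" by simp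
    ultimately have "closed_segment (p + t *\<^sub>R v) ((p + t *\<^sub>R v) + \<delta> *\<^sub>R u) \<inter> frontier S \<noteq> {}"
      by (intro connected_Int_frontier) auto
    then obtain x where x: "x \<in> closed_segment (p + t *\<^sub>R v) ((p + t *\<^sub>R v) + \<delta> *\<^sub>R u)" "x \<in> frontier S"
      by blast
    then obtain c where c: "0 \<le> c" "c \<le> 1" "x = (1 - c) *\<^sub>R (p + t *\<^sub>R v) + c *\<^sub>R ((p + t *\<^sub>R v) + \<delta> *\<^sub>R u)"
      by (auto simp: closed_segment_def)
    then have "x = p + t *\<^sub>R v + (c * \<delta>) *\<^sub>R u" by (simp add: algebra_simps)
    then show ?thesis using x(2) c \<delta>(1) by (intro exI[of _ "c * \<delta>"]) (auto simp: mult_left_le_one_le)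
  qed
  then obtain s where s: "\<And>t. \<bar>t\<bar> < e \<Longrightarrow> 0 \<le> s t \<and> s t \<le> \<delta> \<and> p + t *\<^sub>R v + s t *\<^sub>R u \<in> frontier S"
    by metis
  \<comment> \<open>Both \<open>v\<close> and \<open>- v\<close>, tilted inwards by any
    \<open>\<epsilon> *\<^sub>R u\<close>, point into \<open>S\<close>, so the boundary is met
    before the correction exceeds \<open>\<epsilon> * \<bar>t\<bar>\<close>.\<close>
  have small: "\<exists>d>0. \<forall>t. \<bar>t\<bar> < d \<longrightarrow> s t \<le> \<epsilon> * \<bar>t\<bar>" if \<epsilon>: "\<epsilon> > 0" for \<epsilon>
  proof -
    have in1: "\<exists>d>0. \<forall>t. 0 < t \<and> t < d \<longrightarrow> p + t *\<^sub>R (w + \<epsilon> *\<^sub>R u) \<in> S" if w: "n \<bullet> w = 0" for w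
    proof -
      have "n \<bullet> (w + \<epsilon> *\<^sub>R u) < 0" using w nu \<epsilon> by (simp add: inner_add_right mult_pos_neg)
      then obtain d where "d > 0" "p + d *\<^sub>R (w + \<epsilon> *\<^sub>R u) \<in> S"
        using smooth_normalD(4)[OF assms(4)] by blast
      then show ?thesis using open_convex_ray[OF assms(1,2) pc] by (meson less_imp_le)
    qed
    obtain d1 where d1: "d1 > 0" "\<And>t. 0 < t \<Longrightarrow> t < d1 \<Longrightarrow> p + t *\<^sub>R (v + \<epsilon> *\<^sub>R u) \<in> S"
      using in1[OF nv] by blast
    obtain d2 where d2: "d2 > 0" "\<And>t. 0 < t \<Longrightarrow> t < d2 \<Longrightarrow> p + t *\<^sub>R (-v + \<epsilon> *\<^sub>R u) \<in> S"
      using in1[of "-v"] nv by auto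
    have nS: "s t \<le> \<epsilon> * \<bar>t\<bar>" if t: "\<bar>t\<bar> < min e (min d1 d2)" for t
    proof (rule ccontr)
      assume c: "\<not> s t \<le> \<epsilon> * \<bar>t\<bar>"
      have st: "s t \<le> \<delta>" "p + t *\<^sub>R v + s t *\<^sub>R u \<in> frontier S" using s t by auto
      have cl: "p + t *\<^sub>R v + (\<epsilon> * \<bar>t\<bar>) *\<^sub>R u \<in> closure S"
      proof (cases "t > 0")
        case True
        then have "p + t *\<^sub>R (v + \<epsilon> *\<^sub>R u) \<in> S" using d1 t by auto
        then show ?thesis using True closure_subset[of S] by (auto simp: algebra_simps)
      next
        case False
        show ?thesis
        proof (cases "t = 0")
          case True then show ?thesis using pc by simp
        next
          case f: False
          then have "p + (-t) *\<^sub>R (- v + \<epsilon> *\<^sub>R u) \<in> S" using d2(2)[of "-t"] False t by auto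
          then show ?thesis using False closure_subset[of S] by (auto simp: algebra_simps)
        qed
      qed
      \<comment> \<open>With a larger correction, the boundary point would lie strictly beyond a
        closure point on a ray along \<open>u\<close> that is in \<open>S\<close> at height
        \<open>\<delta>\<close>, so it would itself be in \<open>S\<close>.\<close>
      have "p + t *\<^sub>R v + (\<epsilon> * \<bar>t\<bar>) *\<^sub>R u + (s t - \<epsilon> * \<bar>t\<bar>) *\<^sub>R u \<in> S"
        by (rule open_convex_ray[OF assms(1,2) cl, where t="\<delta> - \<epsilon> * \<bar>t\<bar>"])
          (use c st e(2)[of t] t in \<open>auto simp: algebra_simps\<close>)
      then have "p + t *\<^sub>R v + s t *\<^sub>R u \<in> S" by (simp add: algebra_simps)
      then show False using st(2) assms(1) by (auto simp: frontier_def interior_open)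
    qed
    then show ?thesis using e d1 d2 by (intro exI[of _ "min e (min d1 d2)"]) auto
  qed
  have s0: "s 0 = 0"
  proof -
    obtain d where "d > 0" "\<And>t. \<bar>t\<bar> < d \<Longrightarrow> s t \<le> 1 * \<bar>t\<bar>" using small[of 1] by auto
    from this(2)[of 0] this(1) s[of 0] e(1) show ?thesis by auto
  qed
  define \<gamma> where "\<gamma> t = p + t *\<^sub>R v + s t *\<^sub>R u" for t
  \<comment> \<open>The correction is of smaller order than \<open>t\<close>, so it does not change
    the velocity \<open>v\<close>.\<close>
  have "(s has_derivative (\<lambda>h. 0)) (at 0)"
  proof (rule has_derivativeI_sandwich[where e=e and H="\<lambda>t. \<bar>s t\<bar> / \<bar>t\<bar>"])
    show "(\<lambda>t. \<bar>s t\<bar> / \<bar>t\<bar>) \<midarrow>0\<rightarrow> 0"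
    proof (rule LIM_I)
      fix r :: real assume r: "r > 0"
      then obtain d where d: "d > 0" "\<And>t. \<bar>t\<bar> < d \<Longrightarrow> s t \<le> r/2 * \<bar>t\<bar>" using small[of "r/2"] by auto
      have "\<bar>s t\<bar> / \<bar>t\<bar> < r" if "t \<noteq> 0" "\<bar>t\<bar> < min d e" for t
      proof -
        have "\<bar>s t\<bar> \<le> r/2 * \<bar>t\<bar>" using d(2)[of t] s[of t] that by auto
        also have "\<dots> < r * \<bar>t\<bar>" using r that by simp
        finally show ?thesis using that by (simp add: divide_less_eq)
      qed
      then show "\<exists>d>0. \<forall>x. x \<noteq> 0 \<and> norm (x - 0) < d \<longrightarrow> norm (\<bar>s x\<bar> / \<bar>x\<bar> - 0) < r"
        using d(1) e(1) by (intro exI[of _ "min d e"]) auto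
    qed
  qed (use e(1) s0 in auto)
  then have "(\<gamma> has_vector_derivative v) (at 0)"
    unfolding has_vector_derivative_def \<gamma>_def by (auto intro!: derivative_eq_intros)
  then show "tangent_vector (frontier S) p v"
    unfolding tangent_vector_def
    using e(1) s s0 by (intro exI[of _ \<gamma>] exI[of _ e]) (auto simp: \<gamma>_def)
qed

lemma tangent_line_eq:
  fixes S :: "'a::euclidean_space set"
  assumes "open S" "convex S" "S \<noteq> {}" "smooth_normal S p n"
  shows "tangent_line (frontier S) p = {p + v | v. n \<bullet> v = 0}"
  using tangent_vector_iff[OF assms] by (simp add: tangent_line_def)

subsection \<open>The triple ratio in terms of normals\<close>

text \<open>The point at infinity of a line with normal \<open>n\<close>: the quarter turn of
  \<open>n\<close>, with last homogeneous coordinate \<open>0\<close>.\<close>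

definition direction :: "real^2 \<Rightarrow> real^3" where
  "direction n = vector [- n $ 2, n $ 1, 0]"

lemma homog_nth [simp]: "homog x $ 1 = x $ 1" "homog x $ 2 = x $ 2" "homog x $ 3 = 1"
  by (simp_all add: homog_def)

lemma direction_nth [simp]: "direction x $ 1 = - x $ 2" "direction x $ 2 = x $ 1" "direction x $ 3 = 0"
  by (simp_all add: direction_def)

lemma inner_2: "(x :: real^2) \<bullet> y = x $ 1 * y $ 1 + x $ 2 * y $ 2"
  by (simp add: inner_vec_def sum_2)

text \<open>The bridge from flags to normals: as a function of \<open>x\<close>, the determinant is
  an equation of the tangent line, so each factor of the triple ratio is a kernel value up to
  sign.\<close>

lemma vol_homog_direction:
  "vol (homog p) (direction n) (homog x) = - (n \<bullet> (x - p))"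
  by (simp add: vol_def det_3 inner_2 algebra_simps)

lemma vol_cyclic: "vol u v w = vol v w u"
  by (simp add: vol_def det_3 algebra_simps)

text \<open>The component of the second vector along the first drops out by alternation, so a change
  of adapted basis only rescales each volume.\<close>

lemma vol_adapted_basis:
  "vol (k *\<^sub>R u) (\<alpha> *\<^sub>R u + \<beta> *\<^sub>R v) (l *\<^sub>R w) = k * \<beta> * l * vol u v w"
  by (simp add: vol_def det_3 algebra_simps)

lemma span_homog_line:
  assumes "n \<noteq> 0"
  shows "span (homog ` {p + v | v. n \<bullet> v = 0}) = span {homog p, direction n}"
proof (subst span_eq, rule conjI)
  show "homog ` {p + v | v. n \<bullet> v = 0} \<subseteq> span {homog p, direction n}"
  proof clarify
    fix v assume v: "n \<bullet> v = 0"
    have nn: "n \<bullet> n \<noteq> 0" using assms by simp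
    \<comment> \<open>The coefficient of \<open>v\<close> along the quarter turn of
      \<open>n\<close>, obtained by projection.\<close>
    define c where "c = (n $ 1 * v $ 2 - n $ 2 * v $ 1) / (n \<bullet> n)"
    have "v $ 1 = c * - n $ 2" "v $ 2 = c * n $ 1"
    proof -
      have "v $ 1 * (n \<bullet> n) = (n $ 1 * v $ 2 - n $ 2 * v $ 1) * - n $ 2 + n $ 1 * (n \<bullet> v)"
        by (simp add: inner_2 algebra_simps)
      then show "v $ 1 = c * - n $ 2" using nn v by (simp add: c_def field_simps)
      have "v $ 2 * (n \<bullet> n) = (n $ 1 * v $ 2 - n $ 2 * v $ 1) * n $ 1 + n $ 2 * (n \<bullet> v)"
        by (simp add: inner_2 algebra_simps)
      then show "v $ 2 = c * n $ 1" using nn v by (simp add: c_def field_simps)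
    qed
    then have "homog (p + v) = homog p + c *\<^sub>R direction n"
      by (simp add: vec_eq_iff forall_3)
    then show "homog (p + v) \<in> span {homog p, direction n}"
      by (simp add: span_add span_base span_scale)
  qed
next
  let ?S = "homog ` {p + v | v. n \<bullet> v = 0}"
  have "homog (p + 0) \<in> ?S" by (rule imageI) force
  then have p: "homog p \<in> span ?S" by (simp add: span_base)
  \<comment> \<open>The quarter turn of \<open>n\<close> in the plane; \<open>direction n\<close> is
    then a difference of two homogeneous points of the line.\<close>
  define w :: "real^2" where "w = vector [- n $ 2, n $ 1]"
  have w: "w $ 1 = - n $ 2" "w $ 2 = n $ 1" by (simp_all add: w_def)
  then have "n \<bullet> w = 0" by (simp add: inner_2)
  then have "homog (p + w) \<in> span ?S" by (intro span_base imageI) blast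
  then have "homog (p + w) - homog p \<in> span ?S" using p span_diff by blast
  moreover have "homog (p + w) - homog p = direction n"
    by (simp add: vec_eq_iff forall_3 w)
  ultimately show "{homog p, direction n} \<subseteq> span ?S" using p by simp
qed

lemma direction_notin_span_homog:
  assumes "n \<noteq> 0"
  shows "direction n \<notin> span {homog p}"
proof
  assume "direction n \<in> span {homog p}"
  then obtain k where k: "direction n = k *\<^sub>R homog p" by (auto simp: span_singleton)
  then have "direction n $ 3 = k * homog p $ 3" by simp
  then have "k = 0" by simp
  then have "direction n = 0" using k by simp
  then have "direction n $ 1 = 0" "direction n $ 2 = 0" by simp_all
  then show False using assms by (simp add: vec_eq_iff forall_2)
qed

lemma flag_basis_homog_direction:
  assumes "n \<noteq> 0"
  shows "flag_basis (span {homog p}, span {homog p, direction n}) (homog p) (direction n)"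
proof -
  have "homog p $ 3 \<noteq> 0" by simp
  then have "homog p \<noteq> 0" by (metis zero_index)
  then show ?thesis using direction_notin_span_homog[OF assms] by (simp add: flag_basis_def)
qed

text \<open>All adapted bases of the flag arise from the standard one by an invertible triangular
  change, which is what independence of the choice is tested against.\<close>

lemma flag_basis_homog_directionE:
  assumes "flag_basis (span {homog p}, span {homog p, direction n}) f1 f2"
  obtains k \<alpha> \<beta> where "f1 = k *\<^sub>R homog p" "f2 = \<alpha> *\<^sub>R homog p + \<beta> *\<^sub>R direction n" "k \<noteq> 0" "\<beta> \<noteq> 0"
proof -
  have f: "f1 \<noteq> 0" "f2 \<notin> span {f1}" "span {homog p} = span {f1}"
      "span {homog p, direction n} = span {f1, f2}"
    using assms by (auto simp: flag_basis_def)
  have "f1 \<in> span {homog p}" using f(3) by (simp add: span_base)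
  then obtain k where k: "f1 = k *\<^sub>R homog p" by (auto simp: span_singleton)
  have "f2 \<in> span {homog p, direction n}" using f(4) by (simp add: span_base)
  then obtain \<alpha> where "f2 - \<alpha> *\<^sub>R homog p \<in> span {direction n}" by (auto simp: span_breakdown_eq)
  then obtain \<beta> where b: "f2 - \<alpha> *\<^sub>R homog p = \<beta> *\<^sub>R direction n" by (auto simp: span_singleton)
  then have f2: "f2 = \<alpha> *\<^sub>R homog p + \<beta> *\<^sub>R direction n" by (simp add: algebra_simps)
  have "\<beta> \<noteq> 0"
  proof
    assume "\<beta> = 0"
    then have "f2 \<in> span {homog p}" using f2 by (simp add: span_base span_scale)
    then show False using f by simp
  qed
  moreover have "k \<noteq> 0" using k f(1) by auto
  ultimately show thesis using that k f2 by blast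
qed

lemma vertex_flag_eq:
  assumes "open D" "convex D" "D \<noteq> {}" "smooth_normal D p n"
  shows "vertex_flag D p = (span {homog p}, span {homog p, direction n})"
  using span_homog_line[OF smooth_normal_neq_0[OF assms(4,3)]]
  by (simp add: vertex_flag_def tangent_line_eq[OF assms])

text \<open>In the standard bases each volume is minus a pairing of a normal with a chord, and three
  signs cancel against three. The formula must hold for all bases, since the flag ratio is a
  definite description.\<close>

lemma planar_triple_ratio_eq:
  assumes D: "open D" "convex D" "D \<noteq> {}"
    and n: "smooth_normal D a l" "smooth_normal D b m" "smooth_normal D c n"
  shows "planar_triple_ratio D a b c =
    ((l \<bullet> (b - a)) * (m \<bullet> (c - b)) * (n \<bullet> (a - c))) /
    ((l \<bullet> (c - a)) * (m \<bullet> (a - b)) * (n \<bullet> (b - c)))" (is "_ = ?R")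
proof -
  let ?T = "\<lambda>f1 f2 g1 g2 h1 h2. (vol f1 f2 g1 * vol g1 g2 h1 * vol f1 h1 h2) /
            (vol f1 f2 h1 * vol f1 g1 g2 * vol g1 h1 h2)"
  have T: "?T (homog a) (direction l) (homog b) (direction m) (homog c) (direction n) = ?R"
    by (simp add: vol_homog_direction vol_cyclic[of "homog a" "homog c"]
        vol_cyclic[of "homog a" "homog b"] vol_cyclic[of "homog b" "homog c"])
  have U: "?T f1 f2 g1 g2 h1 h2 = ?R"
    if F: "flag_basis (vertex_flag D a) f1 f2" "flag_basis (vertex_flag D b) g1 g2"
      "flag_basis (vertex_flag D c) h1 h2" for f1 f2 g1 g2 h1 h2
  proof -
    note F' = F[unfolded vertex_flag_eq[OF D n(1)] vertex_flag_eq[OF D n(2)] vertex_flag_eq[OF D n(3)]]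
    obtain k1 \<alpha>1 \<beta>1 where 1: "f1 = k1 *\<^sub>R homog a" "f2 = \<alpha>1 *\<^sub>R homog a + \<beta>1 *\<^sub>R direction l" "k1 \<noteq> 0" "\<beta>1 \<noteq> 0"
      using flag_basis_homog_directionE[OF F'(1)] by blast
    obtain k2 \<alpha>2 \<beta>2 where 2: "g1 = k2 *\<^sub>R homog b" "g2 = \<alpha>2 *\<^sub>R homog b + \<beta>2 *\<^sub>R direction m" "k2 \<noteq> 0" "\<beta>2 \<noteq> 0"
      using flag_basis_homog_directionE[OF F'(2)] by blast
    obtain k3 \<alpha>3 \<beta>3 where 3: "h1 = k3 *\<^sub>R homog c" "h2 = \<alpha>3 *\<^sub>R homog c + \<beta>3 *\<^sub>R direction n" "k3 \<noteq> 0" "\<beta>3 \<noteq> 0"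
      using flag_basis_homog_directionE[OF F'(3)] by blast
    \<comment> \<open>The common scaling of numerator and denominator: in both, every
      \<open>\<beta>\<close> occurs once and every \<open>k\<close> twice.\<close>
    define C where "C = k1 * \<beta>1 * k2 * \<beta>2 * k3 * \<beta>3 * k1 * k2 * k3"
    have C: "C \<noteq> 0" using 1 2 3 by (simp add: C_def)
    have "vol f1 f2 g1 * vol g1 g2 h1 * vol f1 h1 h2 =
        C * - ((l \<bullet> (b - a)) * (m \<bullet> (c - b)) * (n \<bullet> (a - c)))"
      unfolding vol_cyclic[of f1 h1] unfolding 1 2 3 vol_adapted_basis vol_homog_direction C_def
      by (simp only: mult_ac mult_minus_left mult_minus_right)
    moreover have "vol f1 f2 h1 * vol f1 g1 g2 * vol g1 h1 h2 =
        C * - ((l \<bullet> (c - a)) * (m \<bullet> (a - b)) * (n \<bullet> (b - c)))"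
      unfolding vol_cyclic[of f1 g1] vol_cyclic[of g1 h1]
      unfolding 1 2 3 vol_adapted_basis vol_homog_direction C_def
      by (simp only: mult_ac mult_minus_left mult_minus_right)
    ultimately show ?thesis using C by simp
  qed
  have B: "flag_basis (vertex_flag D a) (homog a) (direction l)"
    "flag_basis (vertex_flag D b) (homog b) (direction m)"
    "flag_basis (vertex_flag D c) (homog c) (direction n)"
    using n smooth_normal_neq_0[OF _ D(3)]
    by (auto simp: vertex_flag_eq[OF D] flag_basis_homog_direction)
  show ?thesis
    unfolding planar_triple_ratio_def flag_triple_ratio_def
  proof (rule the_equality)
    show "\<exists>f1 f2 g1 g2 h1 h2. flag_basis (vertex_flag D a) f1 f2 \<and> flag_basis (vertex_flag D b) g1 g2 \<and>
        flag_basis (vertex_flag D c) h1 h2 \<and> ?R = ?T f1 f2 g1 g2 h1 h2"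
      using B T by metis
  qed (use U in metis)
qed

section \<open>Planar sections and affine charts\<close>

text \<open>The adjoint pairs with chart vectors as \<open>n\<close> pairs with their images, so
  both half space conditions pull back. A point of the section is needed to see that
  \<open>p\<close> is still in the closure.\<close>

lemma smooth_normal_vimage:
  fixes A :: "'b::euclidean_space \<Rightarrow> 'a::euclidean_space"
  assumes S: "open S" "convex S" and A: "linear A" and n: "smooth_normal S (q + A p) n"
    and ne: "(\<lambda>x. q + A x) -` S \<noteq> {}"
  shows "smooth_normal ((\<lambda>x. q + A x) -` S) p (adjoint A n)"
proof -
  let ?D = "(\<lambda>x. q + A x) -` S"
  interpret linear A by fact
  have adj: "adjoint A n \<bullet> v = n \<bullet> A v" for v
    using adjoint_works[OF A, of v n] by (simp add: inner_commute)
  have D: "open ?D"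
    using S(1) A by (intro open_vimage continuous_intros) (auto intro: linear_continuous_on simp: linear_linear)
  have neg: "adjoint A n \<bullet> (x - p) < 0" if "x \<in> ?D" for x
    using smooth_normalD(3)[OF n, of "q + A x"] that by (simp add: adj diff)
  have pos: "\<exists>t>0. p + t *\<^sub>R v \<in> ?D" if "adjoint A n \<bullet> v < 0" for v
    using smooth_normalD(4)[OF n, of "A v"] that by (simp add: adj add scale add.assoc)
  \<comment> \<open>The point \<open>p\<close> is outside the section, but is approached along the
    segment from any point \<open>x\<close> of it.\<close>
  have "p \<notin> ?D" using neg by fastforce
  moreover have "p \<in> closure ?D"
  proof -
    obtain x where x: "x \<in> ?D" using ne by blast
    have "p + t *\<^sub>R (x - p) \<in> ?D" if "0 < t" "t \<le> 1" for t
    proof -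
      have "q + A p + t *\<^sub>R (A x - A p) \<in> S"
        by (rule open_convex_ray[OF S smooth_normalD(2)[OF n], where t=1]) (use x that in auto)
      then show ?thesis by (simp add: add diff scale add.assoc)
    qed
    moreover have "((\<lambda>t. p + t *\<^sub>R (x - p)) \<longlongrightarrow> p) (at_right (0::real))"
      by (auto intro!: tendsto_eq_intros)
    moreover have "eventually (\<lambda>t::real. 0 < t \<and> t \<le> 1) (at_right 0)"
      by (auto simp: eventually_at_right_field intro!: exI[of _ 1])
    ultimately show ?thesis
      by (intro Lim_in_closed_set[of "closure ?D" "\<lambda>t. p + t *\<^sub>R (x - p)" "at_right (0::real)"])
        (auto elim!: eventually_mono intro: closure_subset[THEN subsetD])
  qed
  ultimately show ?thesis
    using D neg pos by (auto simp: smooth_normal_def frontier_def interior_open)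
qed

text \<open>Affine coordinates with origin \<open>a\<close> and axes \<open>b - a\<close> and
  \<open>c - a\<close>, which are independent because the points are not collinear. This gives the
  existence half of the definite description of the triple ratio.\<close>

lemma plane_chart_exists:
  fixes a b c :: "'a::euclidean_space"
  assumes "\<not> collinear {a, b, c}"
  obtains \<phi> where "plane_chart \<phi> (affine hull {a, b, c})"
proof -
  define A where "A x = x $ 1 *\<^sub>R (b - a) + x $ 2 *\<^sub>R (c - a)" for x :: "real^2"
  have lin: "linear A" by (rule linearI) (auto simp: A_def algebra_simps)
  have inj: "inj A"
  proof (subst linear_injective_0[OF lin], clarify)
    fix x assume A0: "A x = 0"
    have ind: "x $ 1 *\<^sub>R (b - a) + x $ 2 *\<^sub>R (c - a) = 0" using A0 by (simp add: A_def)
    have nc: "a \<noteq> b" "a \<noteq> c" using assms by (auto simp: insert_commute)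
    have "x $ 2 = 0"
    proof (rule ccontr)
      assume x2: "x $ 2 \<noteq> 0"
      have "x $ 2 *\<^sub>R (c - a) = - x $ 1 *\<^sub>R (b - a)" using ind by (simp add: eq_neg_iff_add_eq_0 add.commute)
      then have "(1 / x $ 2) *\<^sub>R (x $ 2 *\<^sub>R (c - a)) = (- x $ 1 / x $ 2) *\<^sub>R (b - a)" by simp
      then have "c - a = (- x $ 1 / x $ 2) *\<^sub>R (b - a)" using x2 by simp
      then have "collinear {0, b - a, c - a}" unfolding collinear_lemma by blast
      then have "collinear {b, a, c}" by (subst collinear_3) auto
      then show False using assms by (simp add: insert_commute)
    qed
    moreover then have "x $ 1 = 0" using ind nc by simp
    ultimately show "x = 0" by (simp add: vec_eq_iff forall_2)
  qed
  have "range (\<lambda>x. a + A x) = affine hull {a, b, c}"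
  proof (intro equalityI subsetI)
    fix y assume "y \<in> range (\<lambda>x. a + A x)"
    then obtain x where "y = a + A x" by blast
    then have "y = (1 - x $ 1 - x $ 2) *\<^sub>R a + x $ 1 *\<^sub>R b + x $ 2 *\<^sub>R c"
      by (simp add: A_def algebra_simps)
    moreover have "(1 - x $ 1 - x $ 2) + x $ 1 + x $ 2 = 1" by simp
    ultimately show "y \<in> affine hull {a, b, c}" unfolding affine_hull_3 by blast
  next
    fix y assume "y \<in> affine hull {a, b, c}"
    then obtain u v w where y: "y = u *\<^sub>R a + v *\<^sub>R b + w *\<^sub>R c" and "u + v + w = 1"
      unfolding affine_hull_3 by blast
    then have u: "u = 1 - v - w" by simp
    have "y = a + A (vector [v, w])"
      by (simp add: y u A_def algebra_simps)
    then show "y \<in> range (\<lambda>x. a + A x)" by blast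
  qed
  then show thesis using that[of "\<lambda>x. a + A x"] lin inj unfolding plane_chart_def by blast
qed

text \<open>Pairings of pulled back normals with chart chords equal the pairings in the ambient
  space, so every chart gives the same value and no trace of the plane remains.\<close>

lemma triple_ratio_eq:
  fixes S :: "'a::euclidean_space set"
  assumes S: "open S" "strictly_convex S" and abc: "ideal_triangle S a b c"
    and n: "smooth_normal S a l" "smooth_normal S b m" "smooth_normal S c n"
  shows "triple_ratio S a b c =
    ((l \<bullet> (b - a)) * (m \<bullet> (c - b)) * (n \<bullet> (a - c))) /
    ((l \<bullet> (c - a)) * (m \<bullet> (a - b)) * (n \<bullet> (b - c)))" (is "_ = ?R")
proof -
  let ?P = "affine hull {a, b, c}"
  have cv: "convex S" using S by (simp add: strictly_convex_def)
  have nc: "\<not> collinear {a, b, c}" using abc by (simp add: ideal_triangle_def)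
  have U: "planar_triple_ratio (\<phi> -` S) (inv \<phi> a) (inv \<phi> b) (inv \<phi> c) = ?R"
    if \<phi>: "plane_chart \<phi> ?P" for \<phi>
  proof -
    obtain A q where A: "linear A" "inj A" "\<phi> = (\<lambda>x. q + A x)" and r: "range \<phi> = ?P"
      using \<phi> by (auto simp: plane_chart_def)
    interpret linear A by fact
    have P: "a \<in> range \<phi>" "b \<in> range \<phi>" "c \<in> range \<phi>" using r by (auto intro: hull_inc)
    define a' b' c' where d: "a' = inv \<phi> a" "b' = inv \<phi> b" "c' = inv \<phi> c"
    have e: "q + A a' = a" "q + A b' = b" "q + A c' = c"
      using P[THEN f_inv_into_f] by (simp_all add: A(3) d)
    have ab: "a \<noteq> b" using nc by auto
    have D: "open (\<phi> -` S)" unfolding A(3)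
      using S(1) A by (intro open_vimage continuous_intros) (auto intro: linear_continuous_on simp: linear_linear)
    have C: "convex (\<phi> -` S)"
    proof -
      have "\<phi> -` S = A -` ((+) (- q) ` S)" by (force simp: A(3) image_iff)
      then show ?thesis using cv A(1) by (simp add: convex_linear_vimage convex_translation)
    qed
    \<comment> \<open>The chord from \<open>a\<close> to \<open>b\<close> makes a negative product
      with the normal \<open>l\<close>, so the line through \<open>a\<close> and \<open>b\<close>
      meets \<open>S\<close>.\<close>
    have ne: "\<phi> -` S \<noteq> {}"
    proof -
      have "l \<bullet> (b - a) < 0" using smooth_normal_less[OF S n(1) smooth_normalD(1)[OF n(2)] ab] .
      then obtain t where "a + t *\<^sub>R (b - a) \<in> S" using smooth_normalD(4)[OF n(1)] by blast
      also have "a + t *\<^sub>R (b - a) = \<phi> (a' + t *\<^sub>R (b' - a'))"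
        by (simp add: A(3) add diff scale flip: e)
      finally show ?thesis by blast
    qed
    have N: "smooth_normal (\<phi> -` S) a' (adjoint A l)" "smooth_normal (\<phi> -` S) b' (adjoint A m)"
      "smooth_normal (\<phi> -` S) c' (adjoint A n)"
      unfolding A(3) using S(1) cv A(1) n ne[unfolded A(3)] e
      by (auto intro!: smooth_normal_vimage)
    have adj: "adjoint A n \<bullet> (x - y) = n \<bullet> ((q + A x) - (q + A y))" for n x y
      using adjoint_works[OF A(1), of "x - y" n] by (simp add: inner_commute diff)
    show ?thesis
      using planar_triple_ratio_eq[OF D C ne N] by (simp add: adj e flip: d)
  qed
  obtain \<phi> where "plane_chart \<phi> ?P" using plane_chart_exists[OF nc] .
  then show ?thesis
    unfolding triple_ratio_def using U by (intro the_equality) metis+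
qed

subsection \<open>Symmetric kernels and quadrics\<close>

text \<open>Gram-Schmidt orthonormalization for \<open>B\<close>. The subset of \<open>Basis\<close>
  serves only as an index set whose size is at most the dimension.\<close>

lemma orthonormal_wrt_posdef_form:
  fixes B :: "'a::euclidean_space \<Rightarrow> 'a \<Rightarrow> real" and S :: "'a set"
  assumes B: "bilinear B" and sym: "\<And>x y. B x y = B y x" and pos: "\<And>x. x \<noteq> 0 \<Longrightarrow> B x x > 0"
    and S: "S \<subseteq> Basis"
  shows "\<exists>f :: 'a \<Rightarrow> 'a. \<forall>i\<in>S. \<forall>j\<in>S. B (f i) (f j) = (if i = j then 1 else 0)"
proof -
  have "finite S" using S finite_Basis finite_subset by metis
  then show ?thesis using S
  proof (induction S)
    case empty
    show ?case by simp
  next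
    case (insert i S)
    then obtain f where f: "\<And>i j. i \<in> S \<Longrightarrow> j \<in> S \<Longrightarrow> B (f i) (f j) = (if i = j then 1 else 0)"
      by auto
    \<comment> \<open>The vectors found so far are fewer than the dimension, so they do not span and
      a new vector \<open>v\<close> exists.\<close>
    have "card (insert i S) \<le> DIM('a)" using insert.prems finite_Basis card_mono by metis
    then have "card S < DIM('a)" using insert by simp
    then have "card (f ` S) < DIM('a)" using card_image_le[OF insert(1), of f] by linarith
    then have "dim (f ` S) < DIM('a)" using dim_le_card'[of "f ` S"] insert(1) by simp
    then have "span (f ` S) \<noteq> UNIV" using dim_eq_full[of "f ` S"] by force
    then obtain v where v: "v \<notin> span (f ` S)" by blast
    \<comment> \<open>Removing the projection of \<open>v\<close> onto the earlier vectors; only the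
      normalization remains.\<close>
    define w where "w = v - (\<Sum>j\<in>S. B v (f j) *\<^sub>R f j)"
    have "(\<Sum>j\<in>S. B v (f j) *\<^sub>R f j) \<in> span (f ` S)"
      by (intro span_sum span_scale span_base) auto
    then have "w \<noteq> 0" using v by (auto simp: w_def)
    then have ww: "B w w > 0" using pos by blast
    have wj: "B w (f j) = 0" if "j \<in> S" for j
    proof -
      have "linear (\<lambda>x. B x (f j))" using B by (simp add: bilinear_def)
      then have "B w (f j) = B v (f j) - (\<Sum>k\<in>S. B v (f k) * B (f k) (f j))"
        unfolding w_def by (simp add: linear_diff[of "\<lambda>x. B x (f j)"] linear_sum[of "\<lambda>x. B x (f j)"] bilinear_lmul[OF B])
      also have "(\<Sum>k\<in>S. B v (f k) * B (f k) (f j)) = (\<Sum>k\<in>S. if k = j then B v (f k) else 0)"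
        using that by (intro sum.cong) (auto simp: f)
      also have "\<dots> = B v (f j)" using that insert(1) by simp
      finally show ?thesis by simp
    qed
    define g where "g = f(i := (1 / sqrt (B w w)) *\<^sub>R w)"
    have "\<forall>k\<in>insert i S. \<forall>j\<in>insert i S. B (g k) (g j) = (if k = j then 1 else 0)"
      using insert(2) f wj wj[unfolded sym[of w]] ww
      by (auto simp: g_def bilinear_lmul[OF B] bilinear_rmul[OF B] field_simps)
    then show ?case by blast
  qed
qed

text \<open>The linear map sending the standard basis to an orthonormal basis for \<open>B\<close>;
  it turns level sets of the form into round spheres.\<close>

lemma posdef_form_isometric:
  fixes B :: "'a::euclidean_space \<Rightarrow> 'a \<Rightarrow> real"
  assumes B: "bilinear B" and sym: "\<And>x y. B x y = B y x" and pos: "\<And>x. x \<noteq> 0 \<Longrightarrow> B x x > 0"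
  obtains A :: "'a \<Rightarrow> 'a" where "linear A" "bij A" "\<And>x. B (A x) (A x) = x \<bullet> x"
proof -
  obtain f :: "'a \<Rightarrow> 'a" where f: "\<And>i j :: 'a. i \<in> Basis \<Longrightarrow> j \<in> Basis \<Longrightarrow> B (f i) (f j) = (if i = j then 1 else 0)"
    using orthonormal_wrt_posdef_form[OF assms order_refl] by blast
  define A where "A x = (\<Sum>i\<in>Basis. (x \<bullet> i) *\<^sub>R f i)" for x :: 'a
  have lin: "linear A"
    by (rule linearI) (simp_all add: A_def inner_add_left scaleR_add_left sum.distrib scaleR_sum_right)
  have iso: "B (A x) (A x) = x \<bullet> x" for x
  proof -
    have "B (A x) (A x) = (\<Sum>(i,j)\<in>Basis \<times> Basis. B ((x \<bullet> i) *\<^sub>R f i) ((x \<bullet> j) *\<^sub>R f j))"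
      unfolding A_def using bilinear_sum[OF B] by blast
    also have "\<dots> = (\<Sum>i\<in>Basis. \<Sum>j\<in>Basis. (x \<bullet> i) * ((x \<bullet> j) * B (f i) (f j)))"
      by (simp add: bilinear_lmul[OF B] bilinear_rmul[OF B] mult.left_commute flip: sum.cartesian_product)
    also have "\<dots> = (\<Sum>i\<in>Basis. \<Sum>j\<in>Basis. if i = j then (x \<bullet> i) * (x \<bullet> i) else 0)"
      by (intro sum.cong refl) (auto simp: f)
    also have "\<dots> = x \<bullet> x" by (simp add: euclidean_inner[of x x])
    finally show ?thesis .
  qed
  have "inj A"
  proof (subst linear_injective_0[OF lin], clarify)
    fix x assume "A x = 0"
    then have "x \<bullet> x = 0" using iso[of x] by (simp add: bilinear_lzero[OF B])
    then show "x = 0" by simp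
  qed
  then have "bij A" using lin linear_injective_imp_surjective by (auto simp: bij_def)
  then show thesis using that lin iso by blast
qed

text \<open>A symmetric kernel that is affine in one variable is affine in both, hence comes from a
  symmetric bilinear form on the space of homogeneous coordinates.\<close>

lemma symmetric_kernel_extends:
  fixes H :: "'b::euclidean_space set" and \<nu> :: "'b \<Rightarrow> 'b"
  assumes span: "span H = UNIV" and sym: "\<And>x y. x \<in> H \<Longrightarrow> y \<in> H \<Longrightarrow> \<nu> x \<bullet> y = x \<bullet> \<nu> y"
  obtains L where "linear L" "\<And>x y. L x \<bullet> y = x \<bullet> L y" "\<And>x. x \<in> H \<Longrightarrow> L x = \<nu> x"
proof -
  obtain E where E: "E \<subseteq> H" "independent E" "H \<subseteq> span E"
    by (rule maximal_independent_subset[of H])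
  have spE: "span E = UNIV" using span_mono[OF E(3)] span by (simp add: span_span top.extremum_unique)
  \<comment> \<open>Prescribing \<open>L\<close> on a basis taken from \<open>H\<close> suffices:
    symmetry on basis pairs extends linearly in each variable, and agreement with
    \<open>\<nu>\<close> on \<open>H\<close> follows by testing against the basis.\<close>
  obtain L where L: "linear L" "\<And>x. x \<in> E \<Longrightarrow> L x = \<nu> x"
    using linear_independent_extend[OF E(2), of \<nu>] by blast
  interpret linear L by fact
  have ext: "P x = Q x" if "linear P" "linear Q" "\<And>x. x \<in> E \<Longrightarrow> P x = Q x" for P Q :: "'b \<Rightarrow> real" and x
    using linear_eq_on_span[OF that(1,2), of E x] that(3) spE by auto
  have lin1: "linear (\<lambda>x. L x \<bullet> y)" "linear (\<lambda>x. x \<bullet> y)" "linear (\<lambda>x. y \<bullet> L x)" "linear (\<lambda>x. y \<bullet> x)" for y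
    by (auto intro!: linearI simp: add scale inner_add_left inner_add_right)
  have s1: "L x \<bullet> y = x \<bullet> L y" if "x \<in> E" for x y
  proof (rule ext[of "\<lambda>y. L x \<bullet> y" "\<lambda>y. x \<bullet> L y"])
    fix e assume "e \<in> E"
    then show "L x \<bullet> e = x \<bullet> L e" using that E(1) sym[of x e] L(2) by auto
  qed (use lin1 in auto)
  have s2: "L x \<bullet> y = x \<bullet> L y" for x y
    by (rule ext[of "\<lambda>x. L x \<bullet> y" "\<lambda>x. x \<bullet> L y"]) (use s1 lin1 in auto)
  have "L x = \<nu> x" if x: "x \<in> H" for x
  proof -
    have "L x \<bullet> y = \<nu> x \<bullet> y" for y
    proof (rule ext[of "\<lambda>y. L x \<bullet> y" "\<lambda>y. \<nu> x \<bullet> y"])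
      fix e assume e: "e \<in> E"
      then show "L x \<bullet> e = \<nu> x \<bullet> e" using s2[of x e] sym[OF x, of e] E(1) L(2) by auto
    qed (use lin1 in auto)
    then show ?thesis using vector_eq_rdot by blast
  qed
  then show thesis using that L(1) s2 by blast
qed

section \<open>From a symmetric kernel to an ellipsoid\<close>

lemma open_ellipsoid_if_symmetric_kernel:
  fixes S :: "'a::euclidean_space set"
  assumes S: "open S" "bounded S" "S \<noteq> {}"
    and sym: "\<And>a b. a \<in> frontier S \<Longrightarrow> b \<in> frontier S \<Longrightarrow> N a \<bullet> (b - a) = N b \<bullet> (a - b)"
    and less: "\<And>a b. a \<in> frontier S \<Longrightarrow> b \<in> frontier S \<Longrightarrow> a \<noteq> b \<Longrightarrow> N a \<bullet> (b - a) < 0"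
  shows "open_ellipsoid S"
proof -
  define H where "H = (\<lambda>b. (b, 1::real)) ` frontier S"
  \<comment> \<open>Chosen so that the product of \<open>\<nu> (a, 1)\<close> with
    \<open>(b, 1)\<close> is \<open>N a \<bullet> (b - a)\<close>: the kernel, affine in
    \<open>b\<close>, becomes linear in homogeneous coordinates.\<close>
  define \<nu> where "\<nu> x = (N (fst x), - (N (fst x) \<bullet> fst x))" for x :: "'a \<times> real"
  have chord: "\<exists>s t. s > 0 \<and> t > 0 \<and> p + s *\<^sub>R v \<in> frontier S \<and> p - t *\<^sub>R v \<in> frontier S"
    if "p \<in> S" "v \<noteq> 0" for p v
  proof -
    have "p \<in> interior S" using that(1) S(1) by (simp add: interior_open)
    then show ?thesis
      using ray_to_frontier[OF S(2), of p v] ray_to_frontier[OF S(2), of p "-v"] that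
      by (metis add_uminus_conv_diff neg_equal_0_iff_equal scaleR_minus_right)
  qed
  obtain p where p: "p \<in> S" using S(3) by blast
  obtain u :: 'a where u: "u \<noteq> 0" using nonzero_Basis SOME_Basis by blast
  obtain f where f: "f \<in> frontier S" using chord[OF p u] by blast
  \<comment> \<open>Otherwise a nonzero affine function vanishes on the whole frontier; the two ends
    of a chord in its gradient direction show that the gradient is \<open>0\<close>, and then so is
    the constant.\<close>
  have "span H = UNIV"
  proof (rule ccontr)
    assume "span H \<noteq> UNIV"
    then obtain n where n: "n \<noteq> 0" "span H \<subseteq> {x. n \<bullet> x = 0}"
      using span_not_univ_subset_hyperplane by blast
    have h: "fst n \<bullet> b + snd n = 0" if "b \<in> frontier S" for b
    proof -
      have "(b, 1) \<in> span H" using that by (auto simp: H_def intro: span_base)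
      then show ?thesis using n(2) by (auto simp: inner_prod_def)
    qed
    have f0: "fst n = 0"
    proof (rule ccontr)
      assume "fst n \<noteq> 0"
      then obtain s t where st: "s > 0" "t > 0" "p + s *\<^sub>R fst n \<in> frontier S" "p - t *\<^sub>R fst n \<in> frontier S"
        using chord p by blast
      have "(s + t) * (fst n \<bullet> fst n) = 0" using h[OF st(3)] h[OF st(4)] by (simp add: algebra_simps)
      then show False using st \<open>fst n \<noteq> 0\<close> by simp
    qed
    then have "snd n = 0" using h[OF f] by simp
    then show False using n(1) f0 by (simp add: prod_eq_iff)
  qed
  moreover have "\<nu> x \<bullet> y = x \<bullet> \<nu> y" if "x \<in> H" "y \<in> H" for x y
    using that sym[of "fst x" "fst y"] by (auto simp: H_def \<nu>_def inner_prod_def inner_commute algebra_simps)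
  ultimately obtain L where L: "linear L" "\<And>x y. L x \<bullet> y = x \<bullet> L y" "\<And>x. x \<in> H \<Longrightarrow> L x = \<nu> x"
    using symmetric_kernel_extends[of H \<nu>] by blast
  interpret linear L by fact
  have K: "L (a, 1) \<bullet> (b, 1) = N a \<bullet> (b - a)" if "a \<in> frontier S" for a b
    using L(3)[of "(a, 1)"] that by (auto simp: H_def \<nu>_def inner_prod_def inner_diff_right)
  \<comment> \<open>The quadratic part of the form, that is, its restriction to vectors at
    infinity.\<close>
  define M where "M v w = L (v, 0) \<bullet> (w, 0)" for v w :: 'a
  have Msym: "M v w = M w v" for v w using L(2) by (simp add: M_def inner_commute)
  have Mbil: "bilinear M"
  proof -
    have "linear (\<lambda>v. M v w)" for w
    proof (rule linearI)
      show "M (x + y) w = M x w + M y w" for x y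
        using add[of "(x, 0)" "(y, 0)"] by (simp add: M_def inner_add_left)
      show "M (r *\<^sub>R x) w = r *\<^sub>R M x w" for r x
        using scale[of r "(x, 0)"] by (simp add: M_def)
    qed
    moreover from this have "linear (\<lambda>w. M v w)" for v by (subst Msym)
    ultimately show ?thesis by (simp add: bilinear_def)
  qed
  \<comment> \<open>A multiple of \<open>v\<close> is the difference of two frontier points
    \<open>a\<close> and \<open>b\<close>. The diagonal terms of the expanded form vanish, and the
    cross terms give minus twice the negative kernel value.\<close>
  have Mpos: "M v v > 0" if v: "v \<noteq> 0" for v
  proof -
    obtain s t where st: "s > 0" "t > 0" and ab: "p + s *\<^sub>R v \<in> frontier S" "p - t *\<^sub>R v \<in> frontier S"
      using chord p v by blast
    define a b where d: "a = p + s *\<^sub>R v" "b = p - t *\<^sub>R v"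
    note ab = ab[folded d]
    have amb: "a - b = (s + t) *\<^sub>R v" by (simp add: d algebra_simps)
    then have "a \<noteq> b" using st v by auto
    have e: "(s + t) *\<^sub>R (v, 0) = (a, 1) - (b, 1::real)" by (simp add: amb)
    have "(s + t)\<^sup>2 * M v v = L ((s + t) *\<^sub>R (v, 0)) \<bullet> ((s + t) *\<^sub>R (v, 0))"
      unfolding M_def scale inner_scaleR_left inner_scaleR_right by (simp only: power2_eq_square mult.assoc)
    also have "\<dots> = - 2 * (N a \<bullet> (b - a))"
      unfolding e using K[OF ab(1), of a] K[OF ab(1), of b] K[OF ab(2), of a] K[OF ab(2), of b] sym[OF ab]
      by (simp add: diff inner_diff_left inner_diff_right del: diff_Pair)
    also have "\<dots> > 0" using less[OF ab \<open>a \<noteq> b\<close>] by simp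
    finally show ?thesis using st by (simp add: zero_less_mult_iff)
  qed
  \<comment> \<open>The center of the quadric, where the linear part vanishes; it exists because
    \<open>M\<close> is nondegenerate.\<close>
  obtain c where c: "fst (L (c, 1)) = 0"
  proof -
    have lin: "linear (\<lambda>v. fst (L (v, 0)))"
    proof (rule linearI)
      show "fst (L (x + y, 0)) = fst (L (x, 0)) + fst (L (y, 0))" for x y
        using add[of "(x, 0)" "(y, 0)"] by simp
      show "fst (L (r *\<^sub>R x, 0)) = r *\<^sub>R fst (L (x, 0))" for r x
        using scale[of r "(x, 0)"] by simp
    qed
    have "inj (\<lambda>v. fst (L (v, 0)))"
    proof (subst linear_injective_0[OF lin], clarify)
      fix v assume "fst (L (v, 0)) = 0"
      then have "M v v = 0" by (simp add: M_def inner_prod_def)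
      then show "v = 0" using Mpos[of v] by force
    qed
    then have "surj (\<lambda>v. fst (L (v, 0)))" using lin linear_injective_imp_surjective by blast
    from surjD[OF this, of "- fst (L (0, 1))"]
    obtain c where "fst (L (c, 0)) = - fst (L (0, 1))" by (elim exE) (rule that, simp)
    then have "fst (L (c, 1)) = 0" using add[of "(c, 0)" "(0, 1)"] by simp
    then show thesis using that by blast
  qed
  define Q where "Q x = L (x, 1) \<bullet> (x, 1)" for x
  \<comment> \<open>Completing the square at the center.\<close>
  have Qc: "Q (c + v) = M v v + Q c" for v
  proof -
    have e: "(c + v, 1) = (c, 1) + (v, 0::real)" by simp
    have "L (c, 1) \<bullet> (v, 0) = 0" using c by (simp add: inner_prod_def)
    moreover then have "L (v, 0) \<bullet> (c, 1) = 0" using L(2) by (metis inner_commute)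
    ultimately show ?thesis
      unfolding Q_def e add by (simp add: M_def inner_add_left inner_add_right del: add_Pair)
  qed
  have Qf: "Q a = 0" if "a \<in> frontier S" for a using K[OF that, of a] by (simp add: Q_def)
  obtain A :: "'a \<Rightarrow> 'a" where A: "linear A" "bij A" "\<And>x. M (A x) (A x) = x \<bullet> x"
    using posdef_form_isometric[OF Mbil Msym Mpos] by blast
  interpret A: linear A by fact
  define r where "r = sqrt (- Q c)"
  \<comment> \<open>In homogeneous coordinates \<open>p\<close> is a positive combination of the
    ends of a chord through it, and again only the cross term survives.\<close>
  have QS: "Q p < 0" if p: "p \<in> S" for p
  proof -
    obtain s t where st: "s > 0" "t > 0" and ab: "p + s *\<^sub>R u \<in> frontier S" "p - t *\<^sub>R u \<in> frontier S"
      using chord p u by blast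
    define a b where d: "a = p + s *\<^sub>R u" "b = p - t *\<^sub>R u"
    note ab = ab[folded d]
    have "a - b = (s + t) *\<^sub>R u" by (simp add: d algebra_simps)
    then have "a \<noteq> b" using st u by auto
    have e: "(s + t) *\<^sub>R (p, 1) = t *\<^sub>R (a, 1) + s *\<^sub>R (b, 1::real)" by (simp add: d algebra_simps)
    have "(s + t)\<^sup>2 * Q p = L ((s + t) *\<^sub>R (p, 1)) \<bullet> ((s + t) *\<^sub>R (p, 1))"
      unfolding Q_def scale inner_scaleR_left inner_scaleR_right by (simp only: power2_eq_square mult.assoc)
    also have "\<dots> = 2 * s * t * (N a \<bullet> (b - a))"
      unfolding e add scale inner_add_left inner_add_right inner_scaleR_left inner_scaleR_right
      using K[OF ab(1), of a] K[OF ab(1), of b] K[OF ab(2), of a] K[OF ab(2), of b] sym[OF ab]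
      by simp
    also have "\<dots> < 0" using less[OF ab \<open>a \<noteq> b\<close>] st by (simp add: mult_pos_neg)
    finally show ?thesis using st by (simp add: mult_less_0_iff)
  qed
  \<comment> \<open>By \<open>Qc\<close> the value at the center is the minimum of \<open>Q\<close>,
    and \<open>Q\<close> is negative at a point of \<open>S\<close>.\<close>
  have "Q c < 0" using QS[OF p] Qc[of "p - c"] Mpos[of "p - c"] by (cases "p = c") auto
  then have r: "r > 0" "r\<^sup>2 = - Q c" by (auto simp: r_def)
  have injA: "inj A" using A(2) by (rule bij_is_inj)
  have lt: "Q x < 0 \<longleftrightarrow> x \<in> (\<lambda>y. c + r *\<^sub>R A y) ` ball 0 1" for x
  proof -
    obtain y where "x - c = A y" using A(2) by (metis bij_pointE)
    define z where "z = (1 / r) *\<^sub>R y"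
    have x: "x = c + r *\<^sub>R A z" using \<open>x - c = A y\<close> r by (simp add: z_def A.scale algebra_simps)
    have Qcr: "Q c = - r\<^sup>2" using r(2) by simp
    have "M (r *\<^sub>R A z) (r *\<^sub>R A z) = r\<^sup>2 * (z \<bullet> z)"
      by (simp add: bilinear_lmul[OF Mbil] bilinear_rmul[OF Mbil] A(3) power2_eq_square)
    then have "Q x = r\<^sup>2 * (z \<bullet> z - 1)" unfolding x Qc Qcr by (simp add: algebra_simps)
    then have "Q x < 0 \<longleftrightarrow> z \<bullet> z < 1" using r(1) by (simp add: mult_less_0_iff)
    also have "\<dots> \<longleftrightarrow> z \<in> ball 0 1" by (simp add: norm_eq_sqrt_inner)
    also have "\<dots> \<longleftrightarrow> x \<in> (\<lambda>y. c + r *\<^sub>R A y) ` ball 0 1"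
      unfolding x by (rule inj_image_mem_iff[symmetric], rule injI) (use injA r(1) in \<open>simp add: inj_eq\<close>)
    finally show ?thesis .
  qed
  define E where "E = (\<lambda>y. c + r *\<^sub>R A y) ` ball 0 1"
  have lin: "linear (\<lambda>y. r *\<^sub>R A y)" using A(1) by (rule linear_compose_scale_right)
  have "S \<subseteq> E" using QS lt by (auto simp: E_def)
  \<comment> \<open>The ellipsoid \<open>E\<close> is connected and meets \<open>S\<close>; if it
    left \<open>S\<close> it would contain a frontier point, where \<open>Q\<close> is
    \<open>0\<close> and not negative.\<close>
  moreover have "E \<subseteq> S"
  proof (rule ccontr)
    assume "\<not> E \<subseteq> S"
    have "connected E" unfolding E_def using A(1)
      by (intro connected_continuous_image continuous_intros linear_continuous_on)
        (auto simp: linear_linear)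
    then have "E \<inter> frontier S \<noteq> {}"
      using \<open>S \<subseteq> E\<close> p \<open>\<not> E \<subseteq> S\<close> by (intro connected_Int_frontier) auto
    then obtain x where "x \<in> E" "x \<in> frontier S" by blast
    then show False using Qf[of x] lt[of x] by (simp add: E_def)
  qed
  moreover have "inj (\<lambda>y. r *\<^sub>R A y)" by (rule injI) (use injA r(1) in \<open>simp add: inj_eq\<close>)
  ultimately have "linear (\<lambda>y. r *\<^sub>R A y) \<and> inj (\<lambda>y. r *\<^sub>R A y) \<and> S = (\<lambda>y. c + r *\<^sub>R A y) ` ball 0 1"
    using lin by (simp add: E_def)
  then show ?thesis unfolding open_ellipsoid_def
    by (intro exI[of _ "\<lambda>y. r *\<^sub>R A y"] exI[of _ c])
qed

subsection \<open>Normals of ellipsoids and the characterization\<close>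

text \<open>If one of the points were between the other two, its normal would be negative on both
  chords from it, although a convex combination of these chords is \<open>0\<close>. So any three
  distinct boundary points form an ideal triangle.\<close>

lemma strictly_convex_frontier_not_collinear:
  fixes S :: "'a::euclidean_space set"
  assumes S: "open S" "strictly_convex S" "C1_boundary S"
    and f: "a \<in> frontier S" "b \<in> frontier S" "c \<in> frontier S" and d: "a \<noteq> b" "b \<noteq> c" "a \<noteq> c"
  shows "\<not> collinear {a, b, c}"
proof -
  have cv: "convex S" using S by (simp add: strictly_convex_def)
  have *: False if xyz: "between (x, z) y" "x \<in> frontier S" "y \<in> frontier S" "z \<in> frontier S" "x \<noteq> y" "z \<noteq> y"
    for x y z
  proof -
    obtain n where n: "smooth_normal S y n" by (rule C1_boundary_smooth_normal[OF S(1) cv S(3) xyz(3)])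
    have xz: "n \<bullet> (x - y) < 0" "n \<bullet> (z - y) < 0"
      using smooth_normal_less[OF S(1,2) n xyz(2) xyz(5)[symmetric]]
        smooth_normal_less[OF S(1,2) n xyz(4) xyz(6)[symmetric]] .
    obtain t where t: "0 \<le> t" "t \<le> 1" "y = (1 - t) *\<^sub>R x + t *\<^sub>R z"
      using xyz(1) unfolding between_mem_segment closed_segment_def by blast
    have "(1 - t) *\<^sub>R (x - y) + t *\<^sub>R (z - y) = ((1 - t) *\<^sub>R x + t *\<^sub>R z) - y"
      by (simp add: algebra_simps)
    then have "(1 - t) *\<^sub>R (x - y) + t *\<^sub>R (z - y) = 0" using t(3) by simp
    then have "n \<bullet> ((1 - t) *\<^sub>R (x - y) + t *\<^sub>R (z - y)) = 0" by simp
    then have "(1 - t) * (n \<bullet> (x - y)) + t * (n \<bullet> (z - y)) = 0" by (simp add: inner_add_right)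
    moreover have "(1 - t) * (n \<bullet> (x - y)) \<le> 0" "t * (n \<bullet> (z - y)) \<le> 0"
      using xz t by (auto simp: mult_nonneg_nonpos)
    ultimately have "(1 - t) * (n \<bullet> (x - y)) = 0" "t * (n \<bullet> (z - y)) = 0" by linarith+
    then show False using xz by auto
  qed
  from * have "\<not> between (b, c) a" "\<not> between (c, a) b" "\<not> between (a, b) c"
    using f d by metis+
  then show ?thesis unfolding collinear_between_cases by blast
qed

text \<open>The outer normal \<open>\<alpha>\<close> of the unit ball is carried over by the adjoint
  of the inverse of \<open>A\<close>. Keeping this length, instead of normalizing, is what makes the
  kernel symmetric.\<close>

lemma ellipsoid_smooth_normal:
  fixes A :: "'a::euclidean_space \<Rightarrow> 'a"
  assumes A: "linear A" "inj A" and S: "S = (\<lambda>x. c + A x) ` ball 0 1" and p: "p \<in> frontier S"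
  obtains \<alpha> n where "p = c + A \<alpha>" "norm \<alpha> = 1" "smooth_normal S p n"
    "\<And>v. n \<bullet> A v = \<alpha> \<bullet> v"
proof -
  interpret linear A by fact
  obtain A' :: "'a \<Rightarrow> 'a" where A': "linear A'" "\<And>x. A' (A x) = x"
  proof -
    obtain A' :: "'a \<Rightarrow> 'a" where "linear A'" "A' \<circ> A = id"
      using linear_injective_left_inverse[OF A] by blast
    then show thesis using that[of A'] by (simp add: fun_eq_iff)
  qed
  have AA': "A (A' x) = x" for x
  proof -
    obtain y where "x = A y" using surjD[OF linear_injective_imp_surjective[OF A], of x] by blast
    then show ?thesis using A'(2) by simp
  qed
  have fr: "frontier S = (\<lambda>x. c + A x) ` sphere 0 1"
  proof -
    have "frontier (A ` ball 0 1) = A ` sphere 0 1"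
    proof -
      have "frontier (A ` ball 0 1) = A ` closure (ball 0 1) - A ` interior (ball 0 1)"
        unfolding frontier_def
        by (simp only: closure_injective_linear_image[OF A] interior_injective_linear_image[OF A])
      also have "\<dots> = A ` (cball 0 1 - ball 0 1)"
        using A(2) by (simp add: image_set_diff)
      also have "cball 0 1 - ball 0 1 = (sphere 0 1 :: 'a set)" by auto
      finally show ?thesis .
    qed
    moreover have "S = (+) c ` A ` ball 0 1" by (simp add: S image_image)
    ultimately have "frontier S = (+) c ` A ` sphere 0 1" by (simp only: frontier_translation)
    then show ?thesis by (simp only: image_image)
  qed
  then obtain \<alpha> where \<alpha>: "p = c + A \<alpha>" "norm \<alpha> = 1" using p by auto
  define n where "n = adjoint A' \<alpha>"
  have nv: "n \<bullet> A v = \<alpha> \<bullet> v" for v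
    using adjoint_works[OF A'(1), of "A v" \<alpha>] by (simp add: n_def A' inner_commute)
  have "n \<bullet> (x - p) < 0" if x: "x \<in> S" for x
  proof -
    obtain y where y: "x = c + A y" "norm y < 1" using x S by auto
    have "x - p = A (y - \<alpha>)" by (simp add: y \<alpha> diff)
    then have "n \<bullet> (x - p) = \<alpha> \<bullet> y - \<alpha> \<bullet> \<alpha>" by (simp add: nv inner_diff_right)
    moreover have "\<alpha> \<bullet> y \<le> norm \<alpha> * norm y" by (rule norm_cauchy_schwarz)
    ultimately show ?thesis using \<alpha> y by (simp add: dot_square_norm)
  qed
  moreover have "\<exists>t>0. p + t *\<^sub>R v \<in> S" if v: "n \<bullet> v < 0" for v
  proof -
    define w where "w = A' v"
    have vw: "v = A w" by (simp add: w_def AA')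
    have aw: "\<alpha> \<bullet> w < 0" using v by (simp add: vw nv)
    then have w0: "w \<bullet> w > 0" by auto
    \<comment> \<open>The minimizer of the squared norm of \<open>\<alpha> + t *\<^sub>R w\<close>,
      whose minimum is below \<open>1\<close> because the linear term is negative.\<close>
    define t where "t = - (\<alpha> \<bullet> w) / (w \<bullet> w)"
    have t: "t > 0" using aw w0 by (simp add: t_def divide_neg_pos)
    have tw: "t * (w \<bullet> w) = - (\<alpha> \<bullet> w)" using w0 by (simp add: t_def)
    have "(\<alpha> + t *\<^sub>R w) \<bullet> (\<alpha> + t *\<^sub>R w) = \<alpha> \<bullet> \<alpha> + 2 * t * (\<alpha> \<bullet> w) + t * (t * (w \<bullet> w))"
      by (simp add: inner_add_left inner_add_right inner_commute algebra_simps)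
    also have "\<dots> = 1 + t * (\<alpha> \<bullet> w)" unfolding tw using \<alpha>(2) by (simp add: dot_square_norm)
    also have "\<dots> < 1" using t aw by (simp add: mult_pos_neg)
    finally have "norm (\<alpha> + t *\<^sub>R w) < 1" by (simp add: norm_eq_sqrt_inner)
    moreover have "p + t *\<^sub>R v = c + A (\<alpha> + t *\<^sub>R w)" by (simp add: \<alpha> vw add scale)
    ultimately show ?thesis using t S by auto
  qed
  ultimately have "smooth_normal S p n" using p by (simp add: smooth_normal_def)
  then show thesis using that \<alpha> nv by blast
qed

theorem corollary1p20:
  fixes \<Omega> :: "(real ^ 'k) set"
  assumes "open \<Omega>" and "\<Omega> \<noteq> {}" and "bounded \<Omega>"
    and "strictly_convex \<Omega>" and "C1_boundary \<Omega>"
  shows "open_ellipsoid \<Omega> \<longleftrightarrow>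
    (\<forall>a b c. ideal_triangle \<Omega> a b c \<longrightarrow> triple_ratio \<Omega> a b c = 1)"
proof
  assume "open_ellipsoid \<Omega>"
  then obtain A :: "real^'k \<Rightarrow> real^'k" and q where A: "linear A" "inj A" and \<Omega>: "\<Omega> = (\<lambda>x. q + A x) ` ball 0 1"
    unfolding open_ellipsoid_def by blast
  interpret linear A by fact
  show "\<forall>a b c. ideal_triangle \<Omega> a b c \<longrightarrow> triple_ratio \<Omega> a b c = 1"
  proof (intro allI impI)
    fix a b c assume abc: "ideal_triangle \<Omega> a b c"
    then have f: "a \<in> frontier \<Omega>" "b \<in> frontier \<Omega>" "c \<in> frontier \<Omega>"
      and d: "a \<noteq> b" "b \<noteq> c" "a \<noteq> c" by (auto simp: ideal_triangle_def insert_commute)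
    obtain \<alpha> l where a: "a = q + A \<alpha>" "norm \<alpha> = 1" "smooth_normal \<Omega> a l" "\<And>v. l \<bullet> A v = \<alpha> \<bullet> v"
      using ellipsoid_smooth_normal[OF A \<Omega> f(1)] by metis
    obtain \<beta> m where b: "b = q + A \<beta>" "norm \<beta> = 1" "smooth_normal \<Omega> b m" "\<And>v. m \<bullet> A v = \<beta> \<bullet> v"
      using ellipsoid_smooth_normal[OF A \<Omega> f(2)] by metis
    obtain \<gamma> n where c: "c = q + A \<gamma>" "norm \<gamma> = 1" "smooth_normal \<Omega> c n" "\<And>v. n \<bullet> A v = \<gamma> \<bullet> v"
      using ellipsoid_smooth_normal[OF A \<Omega> f(3)] by metis
    have neg: "l \<bullet> (b - a) < 0" "m \<bullet> (c - b) < 0" "l \<bullet> (c - a) < 0"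
      using smooth_normal_less[OF assms(1,4) a(3)] smooth_normal_less[OF assms(1,4) b(3)] f d by blast+
    \<comment> \<open>With these normals the kernel is the inner product of the two unit vectors
      minus \<open>1\<close>, which is symmetric.\<close>
    have kernel: "n \<bullet> ((q + A \<beta>) - (q + A \<alpha>)) = \<alpha> \<bullet> \<beta> - 1"
      if "\<And>v. n \<bullet> A v = \<alpha> \<bullet> v" "norm \<alpha> = 1" for n \<alpha> \<beta>
      using that by (simp add: inner_diff_right dot_square_norm flip: diff)
    have "l \<bullet> (b - a) = m \<bullet> (a - b)" "m \<bullet> (c - b) = n \<bullet> (b - c)" "n \<bullet> (a - c) = l \<bullet> (c - a)"
      using kernel[OF a(4,2)] kernel[OF b(4,2)] kernel[OF c(4,2)]
      by (simp_all add: a(1) b(1) c(1) inner_commute)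
    then show "triple_ratio \<Omega> a b c = 1"
      using triple_ratio_eq[OF assms(1,4) abc a(3) b(3) c(3)] neg by auto
  qed
next
  assume T: "\<forall>a b c. ideal_triangle \<Omega> a b c \<longrightarrow> triple_ratio \<Omega> a b c = 1"
  have cv: "convex \<Omega>" using assms(4) by (simp add: strictly_convex_def)
  obtain n where n: "\<And>p. p \<in> frontier \<Omega> \<Longrightarrow> smooth_normal \<Omega> p (n p)"
  proof -
    have "\<forall>p\<in>frontier \<Omega>. \<exists>n. smooth_normal \<Omega> p n"
      using C1_boundary_smooth_normal[OF assms(1) cv assms(5)] by blast
    then show thesis using that unfolding bchoice_iff by blast
  qed
  define K where "K a b = n a \<bullet> (b - a)" for a b
  have neg: "K a b < 0" if "a \<in> frontier \<Omega>" "b \<in> frontier \<Omega>" "a \<noteq> b" for a b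
    unfolding K_def by (rule smooth_normal_less[OF assms(1,4) n[OF that(1)] that(2,3)])
  \<comment> \<open>If two of the points coincide, both sides contain a factor
    \<open>K x x = 0\<close>; distinct points are never collinear, so the hypothesis on triple
    ratios applies.\<close>
  have cocycle: "K a b * K b c * K c a = K a c * K b a * K c b"
    if f: "a \<in> frontier \<Omega>" "b \<in> frontier \<Omega>" "c \<in> frontier \<Omega>" for a b c
  proof (cases "a = b \<or> b = c \<or> a = c")
    case True
    then show ?thesis by (auto simp: K_def)
  next
    case False
    then have d: "a \<noteq> b" "b \<noteq> c" "a \<noteq> c" by auto
    then have abc: "ideal_triangle \<Omega> a b c"
      using strictly_convex_frontier_not_collinear[OF assms(1,4,5) f] f by (simp add: ideal_triangle_def)
    then have "(K a b * K b c * K c a) / (K a c * K b a * K c b) = 1"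
      using T[rule_format, OF abc] unfolding K_def
      by (simp only: triple_ratio_eq[OF assms(1,4) abc n n n, OF f])
    then show ?thesis by (metis divide_eq_1_iff)
  qed
  obtain p where p: "p \<in> frontier \<Omega>"
    using frontier_eq_empty assms(2,3) not_bounded_UNIV by blast
  \<comment> \<open>By the cocycle identity, rescaling the normals to make \<open>K\<close> symmetric against the base point
    \<open>p\<close> makes it symmetric everywhere. The case \<open>a = p\<close> would be \<open>0 / 0\<close>.\<close>
  define \<mu> where "\<mu> a = (if a = p then 1 else K p a / K a p)" for a
  \<comment> \<open>A quotient of two negative numbers, so rescaling preserves the sign of the
    kernel.\<close>
  have pos: "\<mu> a > 0" if "a \<in> frontier \<Omega>" for a
    using neg[of a p] neg[of p a] that p by (auto simp: \<mu>_def divide_neg_neg)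
  have sym: "\<mu> a * K a b = \<mu> b * K b a" if f: "a \<in> frontier \<Omega>" "b \<in> frontier \<Omega>" for a b
  proof -
    have "K a p < 0" if "a \<noteq> p" using neg[OF f(1) p that] .
    moreover have "K b p < 0" if "b \<noteq> p" using neg[OF f(2) p that] .
    \<comment> \<open>For \<open>a\<close> and \<open>b\<close> different from \<open>p\<close>,
      this is the cocycle identity for \<open>p, a, b\<close> divided by
      \<open>K a p * K b p\<close>.\<close>
    ultimately show ?thesis
      using cocycle[OF p f] by (auto simp: \<mu>_def field_simps)
  qed
  show "open_ellipsoid \<Omega>"
  proof (rule open_ellipsoid_if_symmetric_kernel[OF assms(1,3,2), where N = "\<lambda>a. \<mu> a *\<^sub>R n a"])
    fix a b assume f: "a \<in> frontier \<Omega>" "b \<in> frontier \<Omega>"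
    show "(\<mu> a *\<^sub>R n a) \<bullet> (b - a) = (\<mu> b *\<^sub>R n b) \<bullet> (a - b)"
      using sym[OF f] by (simp add: K_def)
    show "(\<mu> a *\<^sub>R n a) \<bullet> (b - a) < 0" if "a \<noteq> b"
      using pos[OF f(1)] neg[OF f that] by (simp add: K_def mult_pos_neg)
  qed
qed

end
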